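(* Let $\Omega\subset\mathbb R^3$ be a bounded Lipschitz domain with connected boundary $\Gamma$ and outward unit normal $\mathbf n$, and assume the curl range relation $$\nabla\times H(\operatorname{curl};\Omega)=\{\mathbf r\in H(\operatorname{div};\Omega):\operatorname{div}\mathbf r=0,\ \langle\mathbf r\cdot\mathbf n,1\rangle_\Gamma=0\}.$$ Let $\mathcal A=\mathcal A^\top\in L^\infty(\Omega)^{3\times3}$ be uniformly bounded and uniformly positive definite, and let $f\in(H^1_\Gamma(\Omega))'$ and $g\in H^{1/2}(\Gamma)$. Let $u\in H^1_g(\Omega)$ satisfy $$(\mathcal A\nabla u,\mathcal A\nabla v)_\Omega=\langle f,v\rangle\qquad\forall v\in H^1_0(\Omega),$$ and let $\widetilde u\in H^1_\Gamma(\Omega)$ satisfy $$(\mathcal A\nabla\widetilde u,\mathcal A\nabla v)_\Omega=\langle f,v\rangle\qquad\forall v\in H^1_\Gamma(\Omega).$$ Define $\mathbf p:=\mathcal A\nabla\widetilde u-\mathcal A\nabla u$. Then there exists $\boldsymbol\phi\in H(\operatorname{curl};\Omega)$ such that $$\mathbf p=\mathcal A^{-1}(\nabla\times\boldsymbol\phi).$$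
   Context: $T:H^1(\Omega)\to H^{1/2}(\Gamma)$ is the trace operator; $H^1_g(\Omega)=\{w\in H^1(\Omega):Tw=g\}$, $H^1_0(\Omega)=\ker T$, $H^1_\Gamma(\Omega)=\{v\in H^1(\Omega):\int_\Gamma v\,dS=0\}$ (so $H^1_0(\Omega)\subset H^1_\Gamma(\Omega)$). $H(\operatorname{curl};\Omega)=\{\boldsymbol\psi\in L^2(\Omega)^3:\nabla\times\boldsymbol\psi\in L^2(\Omega)^3\}$, $H(\operatorname{div};\Omega)=\{\mathbf r\in L^2(\Omega)^3:\operatorname{div}\mathbf r\in L^2(\Omega)\}$. $(\cdot,\cdot)_\Omega$ is the $L^2(\Omega)$ inner product, $\langle\cdot,\cdot\rangle$ the duality pairing between $(H^1_\Gamma(\Omega))'$ and $H^1_\Gamma(\Omega)$, and $\langle\cdot,\cdot\rangle_\Gamma$ the boundary duality pairing. The function $u$ is the weak solution of $-\operatorname{div}(\mathcal A^2\nabla u)=f$ in $\Omega$, $u=g$ on $\Gamma$. *)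

theory Defs
  imports "HOL-Analysis.Analysis"
begin

text \<open>
  Elements of \<open>L\<^sup>2\<close>, \<open>H\<^sup>1\<close>, etc. are represented by functions on all of \<open>\<real>\<^sup>3\<close>; only their values on
  the domain (or on its boundary) matter, and equations between classes become equations that
  hold almost everywhere.
\<close>

section \<open>Test functions\<close>

definition partial :: "3 \<Rightarrow> (real^3 \<Rightarrow> real) \<Rightarrow> real^3 \<Rightarrow> real" where
  "partial i f x = frechet_derivative f (at x) (axis i 1)"

primrec Ck :: "nat \<Rightarrow> (real^3 \<Rightarrow> real) \<Rightarrow> bool" where
  "Ck 0 f \<longleftrightarrow> continuous_on UNIV f"
| "Ck (Suc k) f \<longleftrightarrow> (\<forall>x. f differentiable (at x)) \<and> (\<forall>i. Ck k (partial i f))"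

definition smooth :: "(real^3 \<Rightarrow> real) \<Rightarrow> bool" where
  "smooth f \<longleftrightarrow> (\<forall>k. Ck k f)"

definition test_fun :: "(real^3) set \<Rightarrow> (real^3 \<Rightarrow> real) set" where
  "test_fun \<Omega> = {\<phi>. smooth \<phi> \<and> compact (closure {x. \<phi> x \<noteq> 0}) \<and> closure {x. \<phi> x \<noteq> 0} \<subseteq> \<Omega>}"

definition test_field :: "(real^3) set \<Rightarrow> (real^3 \<Rightarrow> real^3) set" where
  "test_field \<Omega> = {\<theta>. \<forall>i. (\<lambda>x. \<theta> x $ i) \<in> test_fun \<Omega>}"

definition grad :: "(real^3 \<Rightarrow> real) \<Rightarrow> real^3 \<Rightarrow> real^3" where
  "grad f x = (\<chi> i. partial i f x)"

definition curl :: "(real^3 \<Rightarrow> real^3) \<Rightarrow> real^3 \<Rightarrow> real^3" where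
  "curl F x = vector
     [partial 2 (\<lambda>y. F y $ 3) x - partial 3 (\<lambda>y. F y $ 2) x,
      partial 3 (\<lambda>y. F y $ 1) x - partial 1 (\<lambda>y. F y $ 3) x,
      partial 1 (\<lambda>y. F y $ 2) x - partial 2 (\<lambda>y. F y $ 1) x]"


section \<open>Lebesgue and Sobolev spaces\<close>

definition L2 :: "'a measure \<Rightarrow> ('a \<Rightarrow> 'b::euclidean_space) set" where
  "L2 M = {f \<in> borel_measurable M. integrable M (\<lambda>x. (norm (f x))\<^sup>2)}"

definition Linf :: "'a measure \<Rightarrow> ('a \<Rightarrow> 'b::euclidean_space) set" where
  "Linf M = {f \<in> borel_measurable M. \<exists>C. AE x in M. norm (f x) \<le> C}"

definition L2_inner :: "(real^3) set \<Rightarrow> (real^3 \<Rightarrow> 'b::euclidean_space) \<Rightarrow> (real^3 \<Rightarrow> 'b) \<Rightarrow> real" where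
  "L2_inner \<Omega> f g = (LINT x|lebesgue_on \<Omega>. f x \<bullet> g x)"

definition is_weak_grad :: "(real^3) set \<Rightarrow> (real^3 \<Rightarrow> real) \<Rightarrow> (real^3 \<Rightarrow> real^3) \<Rightarrow> bool" where
  "is_weak_grad \<Omega> u G \<longleftrightarrow> G \<in> L2 (lebesgue_on \<Omega>) \<and>
     (\<forall>\<phi>\<in>test_fun \<Omega>. \<forall>i. L2_inner \<Omega> u (partial i \<phi>) = - L2_inner \<Omega> (\<lambda>x. G x $ i) \<phi>)"

definition is_weak_div :: "(real^3) set \<Rightarrow> (real^3 \<Rightarrow> real^3) \<Rightarrow> (real^3 \<Rightarrow> real) \<Rightarrow> bool" where
  "is_weak_div \<Omega> r d \<longleftrightarrow> d \<in> L2 (lebesgue_on \<Omega>) \<and>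
     (\<forall>\<phi>\<in>test_fun \<Omega>. L2_inner \<Omega> r (grad \<phi>) = - L2_inner \<Omega> d \<phi>)"

definition is_weak_curl :: "(real^3) set \<Rightarrow> (real^3 \<Rightarrow> real^3) \<Rightarrow> (real^3 \<Rightarrow> real^3) \<Rightarrow> bool" where
  "is_weak_curl \<Omega> \<psi> c \<longleftrightarrow> c \<in> L2 (lebesgue_on \<Omega>) \<and>
     (\<forall>\<theta>\<in>test_field \<Omega>. L2_inner \<Omega> \<psi> (curl \<theta>) = L2_inner \<Omega> c \<theta>)"

definition H1 :: "(real^3) set \<Rightarrow> (real^3 \<Rightarrow> real) set" where
  "H1 \<Omega> = {u \<in> L2 (lebesgue_on \<Omega>). \<exists>G. is_weak_grad \<Omega> u G}"

definition Hdiv :: "(real^3) set \<Rightarrow> (real^3 \<Rightarrow> real^3) set" where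
  "Hdiv \<Omega> = {r \<in> L2 (lebesgue_on \<Omega>). \<exists>d. is_weak_div \<Omega> r d}"

definition Hcurl :: "(real^3) set \<Rightarrow> (real^3 \<Rightarrow> real^3) set" where
  "Hcurl \<Omega> = {\<psi> \<in> L2 (lebesgue_on \<Omega>). \<exists>c. is_weak_curl \<Omega> \<psi> c}"

text \<open>The weak derivatives are unique only up to null sets; a representative is chosen.\<close>

definition wgrad :: "(real^3) set \<Rightarrow> (real^3 \<Rightarrow> real) \<Rightarrow> real^3 \<Rightarrow> real^3" where
  "wgrad \<Omega> u = (SOME G. is_weak_grad \<Omega> u G)"

definition wdiv :: "(real^3) set \<Rightarrow> (real^3 \<Rightarrow> real^3) \<Rightarrow> real^3 \<Rightarrow> real" where
  "wdiv \<Omega> r = (SOME d. is_weak_div \<Omega> r d)"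

definition wcurl :: "(real^3) set \<Rightarrow> (real^3 \<Rightarrow> real^3) \<Rightarrow> real^3 \<Rightarrow> real^3" where
  "wcurl \<Omega> \<psi> = (SOME c. is_weak_curl \<Omega> \<psi> c)"

definition H1_norm :: "(real^3) set \<Rightarrow> (real^3 \<Rightarrow> real) \<Rightarrow> real" where
  "H1_norm \<Omega> u = sqrt (L2_inner \<Omega> u u + L2_inner \<Omega> (wgrad \<Omega> u) (wgrad \<Omega> u))"


section \<open>Lipschitz domains and surface measure\<close>

text \<open>Near every boundary point, in suitable orthonormal coordinates, the domain is the part of a
  ball lying above the graph of a Lipschitz function of two variables.\<close>

definition bounded_lipschitz_domain :: "(real^3) set \<Rightarrow> bool" where
  "bounded_lipschitz_domain \<Omega> \<longleftrightarrow>
     open \<Omega> \<and> connected \<Omega> \<and> \<Omega> \<noteq> {} \<and> bounded \<Omega> \<and>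
     (\<forall>x\<in>frontier \<Omega>. \<exists>r>0. \<exists>Q :: real^3 \<Rightarrow> real^3. \<exists>\<gamma> :: real^2 \<Rightarrow> real. \<exists>L.
        orthogonal_transformation Q \<and> L-lipschitz_on UNIV \<gamma> \<and>
        \<Omega> \<inter> ball x r = {y \<in> ball x r. \<gamma> (vector [Q y $ 1, Q y $ 2]) < Q y $ 3})"

text \<open>
  The surface measure is the two-dimensional Hausdorff measure, normalised by the area
  \<open>\<pi> / 4\<close> of the disc of diameter 1 so that it is area on planes. The covering sets
  are required to be bounded because \<^const>\<open>diameter\<close> is meaningless otherwise. The set
  function \<open>hausdorff2\<close> is a metric outer measure, hence countably additive on Borel sets.
\<close>

definition hausdorff2_pre :: "real \<Rightarrow> (real^3) set \<Rightarrow> ennreal" where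
  "hausdorff2_pre \<delta> E =
     (INF C \<in> {C :: nat \<Rightarrow> (real^3) set.
                 (\<forall>n. bounded (C n) \<and> diameter (C n) \<le> \<delta>) \<and> E \<subseteq> (\<Union>n. C n)}.
        \<Sum>n. ennreal (pi / 4 * (diameter (C n))\<^sup>2))"

definition hausdorff2 :: "(real^3) set \<Rightarrow> ennreal" where
  "hausdorff2 E = (SUP \<delta>\<in>{0<..}. hausdorff2_pre \<delta> E)"

definition surface :: "(real^3) set \<Rightarrow> (real^3) measure" where
  "surface \<Omega> = restrict_space (measure_of UNIV (sets borel) hausdorff2) (frontier \<Omega>)"


section \<open>Traces\<close>

text \<open>
  \<open>has_trace \<Omega> w g\<close> means \<open>T w = g\<close>. The trace operator is the continuous extension to \<open>H\<^sup>1(\<Omega>)\<close> of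
  the restriction to the boundary, initially defined on functions smooth up to the boundary; its
  graph is the closure of the graph of that restriction in \<open>H\<^sup>1(\<Omega>) \<times> L\<^sup>2(\<Gamma>)\<close>. That \<open>g\<close> is
  square integrable need not be required: the \<open>w\<^sub>n\<close> are bounded on \<open>\<Gamma>\<close>, which has finite area.
\<close>

definition has_trace :: "(real^3) set \<Rightarrow> (real^3 \<Rightarrow> real) \<Rightarrow> (real^3 \<Rightarrow> real) \<Rightarrow> bool" where
  "has_trace \<Omega> w g \<longleftrightarrow> w \<in> H1 \<Omega> \<and> g \<in> borel_measurable (surface \<Omega>) \<and>
     (\<exists>W :: nat \<Rightarrow> real^3 \<Rightarrow> real. (\<forall>n. smooth (W n)) \<and>
        (\<lambda>n. H1_norm \<Omega> (\<lambda>x. W n x - w x)) \<longlonglongrightarrow> 0 \<and>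
        (\<lambda>n. \<integral>\<^sup>+x. ennreal ((W n x - g x)\<^sup>2) \<partial>surface \<Omega>) \<longlonglongrightarrow> 0)"

text \<open>Intrinsic (Slobodeckij) description of \<open>H\<^bsup>1/2\<^esup>(\<Gamma>)\<close>; the exponent 3 is
  \<open>dim \<Gamma> + 2 \<sqdot> 1/2\<close>.\<close>

definition Hhalf :: "(real^3) set \<Rightarrow> (real^3 \<Rightarrow> real) set" where
  "Hhalf \<Omega> = {g \<in> L2 (surface \<Omega>).
     (\<integral>\<^sup>+x. (\<integral>\<^sup>+y. ennreal ((g x - g y)\<^sup>2 / dist x y ^ 3) \<partial>surface \<Omega>) \<partial>surface \<Omega>) < \<infinity>}"

definition H1_bc :: "(real^3) set \<Rightarrow> (real^3 \<Rightarrow> real) \<Rightarrow> (real^3 \<Rightarrow> real) set" where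
  "H1_bc \<Omega> g = {w \<in> H1 \<Omega>. has_trace \<Omega> w g}"

definition H1_zero :: "(real^3) set \<Rightarrow> (real^3 \<Rightarrow> real) set" where
  "H1_zero \<Omega> = {w \<in> H1 \<Omega>. has_trace \<Omega> w (\<lambda>_. 0)}"

definition H1_Gamma :: "(real^3) set \<Rightarrow> (real^3 \<Rightarrow> real) set" where
  "H1_Gamma \<Omega> = {v \<in> H1 \<Omega>. \<exists>t. has_trace \<Omega> v t \<and> (LINT x|surface \<Omega>. t x) = 0}"

text \<open>Boundedness with respect to the \<open>H\<^sup>1\<close> seminorm on representatives forces such a functional
  to agree on almost everywhere equal functions.\<close>

definition H1_Gamma_dual :: "(real^3) set \<Rightarrow> ((real^3 \<Rightarrow> real) \<Rightarrow> real) set" where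
  "H1_Gamma_dual \<Omega> = {f.
     (\<forall>v\<in>H1_Gamma \<Omega>. \<forall>w\<in>H1_Gamma \<Omega>. f (\<lambda>x. v x + w x) = f v + f w) \<and>
     (\<forall>c. \<forall>v\<in>H1_Gamma \<Omega>. f (\<lambda>x. c * v x) = c * f v) \<and>
     (\<exists>C. \<forall>v\<in>H1_Gamma \<Omega>. \<bar>f v\<bar> \<le> C * H1_norm \<Omega> v)}"

text \<open>
  The pairing \<open>\<langle>r \<sqdot> n, w\<rangle>\<^sub>\<Gamma>\<close> for \<open>r \<in> H(div)\<close> and \<open>w \<in> H\<^bsup>1/2\<^esup>(\<Gamma>)\<close>. For such \<open>r\<close> the normal component
  with respect to the outward unit normal exists only as a functional on \<open>H\<^bsup>1/2\<^esup>(\<Gamma>)\<close>, defined by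
  Green's formula with an arbitrary extension \<open>v\<close> of \<open>w\<close>, the value being independent of \<open>v\<close>.
\<close>

definition normal_pairing :: "(real^3) set \<Rightarrow> (real^3 \<Rightarrow> real^3) \<Rightarrow> (real^3 \<Rightarrow> real) \<Rightarrow> real" where
  "normal_pairing \<Omega> r w =
     (THE c. \<exists>v. has_trace \<Omega> v w \<and> c = L2_inner \<Omega> r (wgrad \<Omega> v) + L2_inner \<Omega> (wdiv \<Omega> r) v)"

text \<open>The image \<open>\<nabla> \<times> H(curl; \<Omega>)\<close>, as the set of all representatives of its elements.\<close>

definition curl_range :: "(real^3) set \<Rightarrow> (real^3 \<Rightarrow> real^3) set" where
  "curl_range \<Omega> = {r \<in> L2 (lebesgue_on \<Omega>). \<exists>\<psi>\<in>Hcurl \<Omega>. AE x in lebesgue_on \<Omega>. r x = wcurl \<Omega> \<psi> x}"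


section \<open>Coefficients\<close>

definition admissible_coeff :: "(real^3) set \<Rightarrow> (real^3 \<Rightarrow> real^3^3) \<Rightarrow> bool" where
  "admissible_coeff \<Omega> A \<longleftrightarrow> A \<in> Linf (lebesgue_on \<Omega>) \<and>
     (AE x in lebesgue_on \<Omega>. transpose (A x) = A x) \<and>
     (\<exists>\<alpha>>0. AE x in lebesgue_on \<Omega>. \<forall>\<xi>. \<alpha> * (norm \<xi>)\<^sup>2 \<le> \<xi> \<bullet> (A x *v \<xi>))"

end

theory Submission
  imports Defs
begin

text \<open>
  Put \<open>r = A p\<close>. Since \<open>A\<close> is pointwise invertible, the claim is that \<open>r\<close> is a curl, and by the curl
  range relation it suffices that \<open>r\<close> is square integrable, divergence free, and has zero normal flux
  through the boundary. All of this follows from one identity: functions of zero trace are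
  admissible in both weak formulations, so subtracting these gives \<open>(r, \<nabla>v) = 0\<close> for all
  \<open>v \<in> H\<^sup>1\<^sub>0(\<Omega>)\<close>.

  Taking test functions for \<open>v\<close> gives \<open>div r = 0\<close> (\<open>weak_div_free_if_orthogonal\<close>). For the
  flux, if \<open>v\<close> has trace \<open>1\<close> then \<open>v - 1\<close> has trace \<open>0\<close> and \<open>\<nabla>v = \<nabla>(v - 1)\<close>, so Green's formula
  yields \<open>\<langle>r \<sqdot> n, 1\<rangle> = (r, \<nabla>v) + (div r, v) = 0\<close> (\<open>normal_pairing_one_eq_0_if_orthogonal\<close>).

  The weak gradient and the weak divergence are chosen representatives, so these arguments rest on
  two facts about test functions. Weak derivatives are unique up to null sets
  (\<open>fundamental_lemma_calculus_of_variations\<close>); this needs a supply of smooth functions with compact support,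
  which is built from \<open>exp (- 1 / t)\<close> and shown to approximate the indicator of every open set
  (\<open>indicator_open_limit_test_fun\<close>). And partial derivatives of test functions have integral zero
  (\<open>integral_partial_test_fun\<close>), so constants have weak gradient zero and the weak gradient of a test
  function is its classical gradient.
\<close>

section \<open>Smooth functions\<close>

lemma partial_eq:
  assumes "(f has_derivative D) (at x)"
  shows "partial i f x = D (axis i 1)"
  using frechet_derivative_at[OF assms] by (simp add: partial_def)

text \<open>
  The recursion of \<^const>\<open>Ck\<close> runs through partial derivatives, so closure properties follow by
  induction on \<open>k\<close> once the derivative of the combined function is written as an expression in
  functions that are known to be in \<open>C\<^sup>k\<close>. This rule and the next one are the two directions of that
  step.
\<close>

lemma Ck_SucI:
  assumes "\<And>x. (f has_derivative D x) (at x)"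
    and "\<And>i. Ck k (\<lambda>x. D x (axis i 1))"
  shows "Ck (Suc k) f"
proof -
  have "partial i f = (\<lambda>x. D x (axis i 1))" for i
    using partial_eq[OF assms(1)] by auto
  then show ?thesis
    using assms by (auto simp: differentiable_def)
qed

lemma Ck_SucE:
  assumes "Ck (Suc k) f"
  obtains D where "\<And>x. (f has_derivative D x) (at x)" 
    "\<And>i. (\<lambda>x. D x (axis i 1)) = partial i f" "\<And>i. Ck k (partial i f)"
proof (rule that[of "\<lambda>x. frechet_derivative f (at x)"])
  show "(f has_derivative frechet_derivative f (at x)) (at x)" for x
    using assms frechet_derivative_works by auto
  show "(\<lambda>x. frechet_derivative f (at x) (axis i 1)) = partial i f" for i
    by (auto simp: partial_def)
  show "Ck k (partial i f)" for i
    using assms by auto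
qed

lemma Ck_SucD: "Ck (Suc k) f \<Longrightarrow> Ck k f"
proof (induction k arbitrary: f)
  case 0
  then show ?case
    by (auto simp: continuous_on_eq_continuous_within differentiable_imp_continuous_within)
next
  case (Suc k)
  then show ?case by (metis Ck.simps(2))
qed

lemma Ck_const [simp]: "Ck k (\<lambda>x. c)"
proof (induction k arbitrary: c)
  case (Suc k)
  show ?case by (rule Ck_SucI[where D="\<lambda>_ _. 0"]) (auto simp: Suc)
qed auto

lemma Ck_add: "Ck k f \<Longrightarrow> Ck k g \<Longrightarrow> Ck k (\<lambda>x. f x + g x)"
proof (induction k arbitrary: f g)
  case 0
  then show ?case by (auto intro: continuous_intros)
next
  case (Suc k)
  obtain D where D: "\<And>x. (f has_derivative D x) (at x)" 
    "\<And>i. (\<lambda>x. D x (axis i 1)) = partial i f" "\<And>i. Ck k (partial i f)"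
    using Ck_SucE[OF Suc.prems(1)] by blast
  obtain E where E: "\<And>x. (g has_derivative E x) (at x)" 
    "\<And>i. (\<lambda>x. E x (axis i 1)) = partial i g" "\<And>i. Ck k (partial i g)"
    using Ck_SucE[OF Suc.prems(2)] by blast
  show ?case
  proof (rule Ck_SucI)
    show "((\<lambda>x. f x + g x) has_derivative (\<lambda>h. D x h + E x h)) (at x)" for x
      by (intro derivative_intros D E)
    show "Ck k (\<lambda>x. D x (axis i 1) + E x (axis i 1))" for i
      using Suc.IH[of "\<lambda>x. D x (axis i 1)" "\<lambda>x. E x (axis i 1)"] D(2,3) E(2,3) by simp
  qed
qed

lemma Ck_mult: "Ck k f \<Longrightarrow> Ck k g \<Longrightarrow> Ck k (\<lambda>x. f x * g x)"
proof (induction k arbitrary: f g)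
  case 0
  then show ?case by (auto intro: continuous_intros)
next
  case (Suc k)
  obtain D where D: "\<And>x. (f has_derivative D x) (at x)" 
    "\<And>i. (\<lambda>x. D x (axis i 1)) = partial i f" "\<And>i. Ck k (partial i f)"
    using Ck_SucE[OF Suc.prems(1)] by blast
  obtain E where E: "\<And>x. (g has_derivative E x) (at x)" 
    "\<And>i. (\<lambda>x. E x (axis i 1)) = partial i g" "\<And>i. Ck k (partial i g)"
    using Ck_SucE[OF Suc.prems(2)] by blast
  show ?case
  proof (rule Ck_SucI)
    show "((\<lambda>x. f x * g x) has_derivative (\<lambda>h. f x * E x h + D x h * g x)) (at x)" for x
      by (intro derivative_intros D E)
    show "Ck k (\<lambda>x. f x * E x (axis i 1) + D x (axis i 1) * g x)" for i
    proof (rule Ck_add)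
      show "Ck k (\<lambda>x. f x * E x (axis i 1))"
        using Suc.IH[of f "\<lambda>x. E x (axis i 1)"] Ck_SucD[OF Suc.prems(1)] E(2,3) by simp
      show "Ck k (\<lambda>x. D x (axis i 1) * g x)"
        using Suc.IH[of "\<lambda>x. D x (axis i 1)" g] Ck_SucD[OF Suc.prems(2)] D(2,3) by simp
    qed
  qed
qed

lemma Ck_exp: "Ck k f \<Longrightarrow> Ck k (\<lambda>x. exp (f x))"
proof (induction k arbitrary: f)
  case 0
  then show ?case by (auto intro: continuous_intros)
next
  case (Suc k)
  obtain D where D: "\<And>x. (f has_derivative D x) (at x)" 
    "\<And>i. (\<lambda>x. D x (axis i 1)) = partial i f" "\<And>i. Ck k (partial i f)"
    using Ck_SucE[OF Suc.prems(1)] by blast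
  show ?case
  proof (rule Ck_SucI)
    show "((\<lambda>x. exp (f x)) has_derivative (\<lambda>h. D x h * exp (f x))) (at x)" for x
      by (auto intro!: derivative_eq_intros D)
    show "Ck k (\<lambda>x. D x (axis i 1) * exp (f x))" for i
      using Ck_mult[OF D(3) Suc.IH[OF Ck_SucD[OF Suc.prems]], of i] D(2)[of i, symmetric] by simp
  qed
qed

lemma smooth_const: "smooth (\<lambda>x. c)"
  and smooth_add: "smooth f \<Longrightarrow> smooth g \<Longrightarrow> smooth (\<lambda>x. f x + g x)"
  and smooth_mult: "smooth f \<Longrightarrow> smooth g \<Longrightarrow> smooth (\<lambda>x. f x * g x)"
  and smooth_exp: "smooth f \<Longrightarrow> smooth (\<lambda>x. exp (f x))"
  by (auto simp: smooth_def Ck_add Ck_mult Ck_exp)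

lemma smooth_diff: "smooth f \<Longrightarrow> smooth g \<Longrightarrow> smooth (\<lambda>x. f x - g x)"
  using smooth_add[of f "\<lambda>x. -1 * g x"] smooth_mult[OF smooth_const, of g "-1"] by simp

lemma smooth_sum: "(\<And>j. j \<in> I \<Longrightarrow> smooth (f j)) \<Longrightarrow> smooth (\<lambda>x. \<Sum>j\<in>I. f j x)"
  by (induction I rule: infinite_finite_induct) (auto intro: smooth_const smooth_add)

lemma smooth_prod: "(\<And>j. j \<in> I \<Longrightarrow> smooth (f j)) \<Longrightarrow> smooth (\<lambda>x. \<Prod>j\<in>I. f j x)"
  by (induction I rule: infinite_finite_induct) (auto intro: smooth_const smooth_mult)

lemma smooth_partial: "smooth f \<Longrightarrow> smooth (partial i f)"
  by (metis smooth_def Ck.simps(2))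

lemma smooth_continuous: "smooth f \<Longrightarrow> continuous_on S f"
  by (metis smooth_def Ck.simps(1) continuous_on_subset subset_UNIV)

lemma smooth_has_derivative: "smooth f \<Longrightarrow> (f has_derivative frechet_derivative f (at x)) (at x)"
  by (metis smooth_def Ck.simps(2) frechet_derivative_works)

text \<open>
  The case \<open>n = 0\<close> is the classical smooth function that vanishes to infinite order at \<open>0\<close>. The
  factors \<open>t\<^sup>-\<^sup>n\<close> are carried along because this family is closed under differentiation up to linear
  combinations, which turns smoothness into an induction over \<open>k\<close> for all \<open>n\<close> at once.
\<close>

definition flat :: "nat \<Rightarrow> real \<Rightarrow> real" where
  "flat n t = (if t > 0 then inverse t ^ n * exp (- inverse t) else 0)"

lemma flat_tendsto_0: "((\<lambda>t. flat n t) \<longlongrightarrow> 0) (at 0)"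
proof -
  have "((\<lambda>t. inverse t ^ n / exp (inverse t)) \<longlongrightarrow> (0::real)) (at_right 0)"
    using filterlim_compose[OF tendsto_power_div_exp_0 filterlim_inverse_at_top_right] .
  then have r: "((\<lambda>t. flat n t) \<longlongrightarrow> 0) (at_right 0)"
    by (rule Lim_transform_eventually)
       (auto simp: eventually_at_filter flat_def exp_minus divide_inverse)
  have l: "((\<lambda>t. flat n t) \<longlongrightarrow> 0) (at_left 0)"
    by (rule Lim_transform_eventually[OF tendsto_const])
       (auto simp: eventually_at_filter flat_def)
  show ?thesis using l r by (simp add: filterlim_split_at_real)
qed

text \<open>
  At \<open>t = 0\<close> the difference quotient of \<open>flat n\<close> is \<open>flat (n + 1)\<close>, so differentiability there is the
  limit \<open>flat_tendsto_0\<close>.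
\<close>

lemma flat_has_derivative:
  "(flat n has_real_derivative (flat (n + 2) t - real n * flat (n + 1) t)) (at t)"
proof (cases t "0::real" rule: linorder_cases)
  case less
  have "((\<lambda>_. 0) has_real_derivative (flat (n + 2) t - real n * flat (n + 1) t)) (at t)"
    using less by (simp add: flat_def)
  then show ?thesis
    by (rule DERIV_cong_ev[THEN iffD1, rotated -1])
       (use less in \<open>auto simp: flat_def eventually_nhds intro!: exI[of _ "{..<0}"]\<close>)
next
  case equal
  have "((\<lambda>h. flat (n + 1) h) \<longlongrightarrow> 0) (at 0)" by (rule flat_tendsto_0)
  then have "((\<lambda>h. flat n h / h) \<longlongrightarrow> 0) (at 0)"
    by (rule Lim_transform_eventually)
       (auto simp: eventually_at_filter flat_def divide_inverse)
  then show ?thesis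
    using equal by (simp add: DERIV_def flat_def)
next
  case greater
  have d: "((\<lambda>t. inverse t ^ n) has_real_derivative (- (real n * inverse t ^ (n + 1)))) (at t)"
  proof (cases n)
    case (Suc m)
    show ?thesis
      unfolding Suc
      by (rule DERIV_cong[OF DERIV_power_Suc[OF DERIV_inverse]]) (use greater in auto)
  qed simp
  have e: "((\<lambda>t. exp (- inverse t)) has_real_derivative (inverse t ^ 2 * exp (- inverse t))) (at t)"
    using greater by (auto intro!: derivative_eq_intros simp: power2_eq_square)
  have "((\<lambda>t. inverse t ^ n * exp (- inverse t)) has_real_derivative
      (flat (n + 2) t - real n * flat (n + 1) t)) (at t)"
    by (rule DERIV_cong[OF DERIV_mult[OF d e]]) (use greater in \<open>simp add: flat_def power_add power2_eq_square algebra_simps\<close>)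
  then show ?thesis
    by (rule DERIV_cong_ev[THEN iffD1, rotated -1])
       (use greater in \<open>auto simp: flat_def eventually_nhds intro!: exI[of _ "{0<..}"]\<close>)
qed

lemma Ck_flat: "Ck k (\<lambda>x. flat n (c * x $ i + d))"
proof (induction k arbitrary: n)
  case 0
  have "continuous_on UNIV (flat n)"
    by (meson DERIV_isCont continuous_at_imp_continuous_on flat_has_derivative)
  then have "continuous_on UNIV (flat n \<circ> (\<lambda>x::real^3. c * x $ i + d))"
    by (intro continuous_on_compose continuous_intros) (auto intro: continuous_on_subset)
  then show ?case by (simp add: o_def)
next
  case (Suc k)
  let ?t = "\<lambda>x::real^3. c * x $ i + d"
  show ?case
  proof (rule Ck_SucI)
    show "((\<lambda>x. flat n (?t x)) has_derivative
       (\<lambda>h. (c * h $ i) * (flat (n + 2) (?t x) - real n * flat (n + 1) (?t x)))) (at x)" for x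
    proof -
      have "(?t has_derivative (\<lambda>h. c * h $ i)) (at x)"
        by (auto intro!: derivative_eq_intros bounded_linear_imp_has_derivative bounded_linear_vec_nth)
      from has_derivative_compose[OF this flat_has_derivative[unfolded has_field_derivative_def]]
      show ?thesis by (simp add: mult.commute)
    qed
    have "Ck k (\<lambda>x. flat (n + 2) (?t x) + (- real n) * flat (n + 1) (?t x))"
      by (intro Ck_add Ck_mult Ck_const Suc)
    from Ck_mult[OF Ck_const this]
    show "Ck k (\<lambda>x. (c * (axis j 1 :: real^3) $ i) * (flat (n + 2) (?t x) - real n * flat (n + 1) (?t x)))" for j
      by simp
  qed
qed

definition bump :: "real^3 \<Rightarrow> real^3 \<Rightarrow> real^3 \<Rightarrow> real" where
  "bump a b x = (\<Prod>i\<in>UNIV. flat 0 (x $ i - a $ i) * flat 0 (b $ i - x $ i))"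

lemma smooth_bump: "smooth (bump a b)"
proof -
  have "smooth (\<lambda>x. flat 0 (x $ i - a $ i) * flat 0 (b $ i - x $ i))" for i
    using Ck_flat[of _ 0 1 i "- a $ i"] Ck_flat[of _ 0 "-1" i "b $ i"]
    by (intro smooth_mult) (auto simp: smooth_def)
  then show ?thesis unfolding bump_def[abs_def] by (intro smooth_prod)
qed

lemma bump_pos: "x \<in> box a b \<Longrightarrow> bump a b x > 0"
  by (auto simp: bump_def flat_def mem_box_cart intro!: prod_pos)

lemma bump_nonneg: "bump a b x \<ge> 0"
  by (auto simp: bump_def flat_def intro!: prod_nonneg)

lemma bump_zero: "x \<notin> box a b \<Longrightarrow> bump a b x = 0"
  by (auto simp: bump_def flat_def mem_box_cart)

section \<open>Test functions\<close>

lemma test_funI: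
  assumes "smooth \<phi>" "compact K" "K \<subseteq> U" "\<And>x. x \<notin> K \<Longrightarrow> \<phi> x = 0"
  shows "\<phi> \<in> test_fun U"
proof -
  have "{x. \<phi> x \<noteq> 0} \<subseteq> K" using assms(4) by auto
  then have *: "closure {x. \<phi> x \<noteq> 0} \<subseteq> K"
    using assms(2) by (simp add: closure_minimal compact_imp_closed)
  then have "compact (closure {x. \<phi> x \<noteq> 0})"
    using assms(2) by (meson bounded_subset closed_closure compact_eq_bounded_closed)
  with * assms show ?thesis unfolding test_fun_def by auto
qed

lemma test_funE:
  assumes "\<phi> \<in> test_fun U"
  obtains K where "smooth \<phi>" "compact K" "K \<subseteq> U" "\<And>x. x \<notin> K \<Longrightarrow> \<phi> x = 0"
  using assms closure_subset[of "{x. \<phi> x \<noteq> 0}"]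
  unfolding test_fun_def by blast

lemma test_fun_mono: "\<phi> \<in> test_fun U \<Longrightarrow> U \<subseteq> V \<Longrightarrow> \<phi> \<in> test_fun V"
  unfolding test_fun_def by blast

lemma test_fun_outside: "\<phi> \<in> test_fun U \<Longrightarrow> x \<notin> U \<Longrightarrow> \<phi> x = 0"
  by (metis test_funE subsetD)

lemma test_fun_mult:
  assumes "\<phi> \<in> test_fun U" "smooth f"
  shows "(\<lambda>x. f x * \<phi> x) \<in> test_fun U"
proof -
  obtain K where K: "smooth \<phi>" "compact K" "K \<subseteq> U" "\<And>x. x \<notin> K \<Longrightarrow> \<phi> x = 0"
    using assms(1) by (rule test_funE) blast
  show ?thesis
    by (rule test_funI[OF smooth_mult[OF assms(2) K(1)] K(2,3)]) (simp add: K(4))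
qed

lemma test_fun_partial:
  assumes "\<phi> \<in> test_fun U"
  shows "partial i \<phi> \<in> test_fun U"
proof -
  obtain K where K: "smooth \<phi>" "compact K" "K \<subseteq> U" "\<And>x. x \<notin> K \<Longrightarrow> \<phi> x = 0"
    using assms by (rule test_funE) blast
  show ?thesis
  proof (rule test_funI[OF smooth_partial[OF K(1)] K(2,3)])
    fix x assume "x \<notin> K"
    have "(\<phi> has_derivative (\<lambda>_. 0)) (at x)"
      by (rule has_derivative_transform_within_open[OF has_derivative_const, of "- K"])
         (use K \<open>x \<notin> K\<close> in \<open>auto simp: compact_imp_closed open_Compl\<close>)
    from partial_eq[OF this] show "partial i \<phi> x = 0" by simp
  qed
qed

text \<open>
  There are enough test functions to see every open set \<open>U\<close>: by Lindelof's theorem \<open>U\<close> is a countable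
  union of open boxes whose closures lie in \<open>U\<close>. The sum \<open>\<Phi>\<^sub>n\<close> of the bumps of the first \<open>n\<close> boxes is
  increasing in \<open>n\<close>, positive on these boxes, and zero outside them. Hence \<open>1 - exp (- n \<Phi>\<^sub>n)\<close> is a
  smooth function with compact support in \<open>U\<close>, takes values in \<open>[0, 1]\<close>, and tends to \<open>1\<close> on \<open>U\<close>.
\<close>

lemma indicator_open_limit_test_fun:
  fixes U :: "(real^3) set"
  assumes "open U"
  obtains \<psi> :: "nat \<Rightarrow> real^3 \<Rightarrow> real"
  where "\<And>n. \<psi> n \<in> test_fun U" "\<And>n x. \<bar>\<psi> n x\<bar> \<le> 1"
    "\<And>x. (\<lambda>n. \<psi> n x) \<longlonglongrightarrow> indicator U x"
proof -
  define F where "F = {box a b | a b. cbox a b \<subseteq> U}"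
  obtain F' where F': "F' \<subseteq> F" "countable F'" "\<Union>F' = \<Union>F"
    by (rule Lindelof[of F]) (auto simp: F_def)
  have "U \<subseteq> \<Union>F"
  proof
    fix x assume "x \<in> U"
    then obtain a b where "x \<in> box a b" "cbox a b \<subseteq> U"
      using open_contains_cbox[THEN iffD1, OF assms] by metis
    then show "x \<in> \<Union>F" unfolding F_def by blast
  qed
  moreover have "\<Union>F \<subseteq> U"
    unfolding F_def using box_subset_cbox by blast
  ultimately have UF: "U = \<Union>F'"
    using F'(3) by simp
  \<comment> \<open>The empty box is added so that the cover can be enumerated by the natural numbers even if it is
    empty.\<close>
  have emp: "{} \<in> F"
  proof -
    have "box 1 (0::real^3) = {}" "cbox 1 (0::real^3) = {}"
      by (simp_all add: interval_eq_empty_cart)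
    then show ?thesis unfolding F_def by force
  qed
  define B where "B = from_nat_into (insert {} F')"
  have rB: "range B = insert {} F'"
    unfolding B_def using F' by (intro range_from_nat_into) auto
  have "\<forall>n. \<exists>a b. B n = box a b \<and> cbox a b \<subseteq> U"
  proof
    fix n
    have "B n \<in> insert {} F'" using rB by blast
    then have "B n \<in> F" using F'(1) emp by auto
    then show "\<exists>a b. B n = box a b \<and> cbox a b \<subseteq> U" unfolding F_def by simp
  qed
  then obtain a b where ab: "\<And>n. B n = box (a n) (b n)" "\<And>n. cbox (a n) (b n) \<subseteq> U"
    by metis
  define \<Phi> where "\<Phi> n x = (\<Sum>j<n. bump (a j) (b j) x)" for n x
  define \<psi> where "\<psi> n x = 1 - exp (- real n * \<Phi> n x)" for n x
  have \<Phi>0: "\<Phi> n x \<ge> 0" for n x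
    unfolding \<Phi>_def by (intro sum_nonneg bump_nonneg)
  show ?thesis
  proof
    fix n
    let ?K = "\<Union>j<n. cbox (a j) (b j)"
    have "smooth (\<psi> n)"
      unfolding \<psi>_def[abs_def] \<Phi>_def[abs_def]
      by (rule smooth_diff[OF smooth_const smooth_exp[OF smooth_mult[OF smooth_const smooth_sum[OF smooth_bump]]]])
    moreover have K: "compact ?K" "?K \<subseteq> U"
    proof -
      show "compact ?K" by (rule compact_UN) auto
      show "?K \<subseteq> U" using ab(2) by blast
    qed
    moreover have "\<psi> n x = 0" if "x \<notin> ?K" for x
    proof -
      have "bump (a j) (b j) x = 0" if "j < n" for j
        using that \<open>x \<notin> ?K\<close> box_subset_cbox[of "a j" "b j"] by (intro bump_zero) auto
      then have "\<Phi> n x = 0" by (simp add: \<Phi>_def)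
      then show ?thesis by (simp add: \<psi>_def)
    qed
    ultimately show "\<psi> n \<in> test_fun U"
      using K by (intro test_funI[of "\<psi> n" ?K])
  next
    fix n x
    have "exp (- real n * \<Phi> n x) \<le> 1" using \<Phi>0 by simp
    moreover have "exp (- real n * \<Phi> n x) > 0" by simp
    ultimately show "\<bar>\<psi> n x\<bar> \<le> 1" unfolding \<psi>_def by linarith
  next
    fix x
    show "(\<lambda>n. \<psi> n x) \<longlonglongrightarrow> indicator U x"
    proof (cases "x \<in> U")
      case False
      then have "bump (a j) (b j) x = 0" for j
        using ab(2)[of j] box_subset_cbox[of "a j" "b j"] by (intro bump_zero) auto
      then have "\<Phi> n x = 0" for n by (simp add: \<Phi>_def)
      then show ?thesis using False by (simp add: \<psi>_def)
    next
      case True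
      then obtain j where j: "x \<in> box (a j) (b j)"
        using UF rB ab(1) by (metis UnionE insertCI rangeE)
      let ?e = "bump (a j) (b j) x"
      have e: "?e > 0" using j by (rule bump_pos)
      have "(\<lambda>n. exp (- real n * ?e)) \<longlonglongrightarrow> 0"
        using LIMSEQ_realpow_zero[of "exp (- ?e)"] e by (simp add: exp_of_nat_mult[symmetric])
      then have "(\<lambda>n. exp (- real n * \<Phi> n x)) \<longlonglongrightarrow> 0"
      proof (rule Lim_null_comparison[rotated])
        show "\<forall>\<^sub>F n in sequentially. norm (exp (- real n * \<Phi> n x)) \<le> exp (- real n * ?e)"
          using eventually_gt_at_top[of j]
        proof eventually_elim
          case (elim n)
          then have "?e \<le> \<Phi> n x"
            unfolding \<Phi>_def by (intro member_le_sum) (auto intro: bump_nonneg)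
          then show ?case by (simp add: mult_left_mono)
        qed
      qed
      then have "(\<lambda>n. \<psi> n x) \<longlonglongrightarrow> 1 - 0"
        unfolding \<psi>_def by (intro tendsto_intros)
      then show ?thesis using True by simp
    qed
  qed
qed

section \<open>The fundamental lemma of the calculus of variations\<close>

text \<open>
  The set where \<open>h > 0\<close> is, up to a null set, a countable union of compact sets. On each of them a
  positive function has integral zero, so each of them is null.
\<close>

lemma AE_nonpos_if_compact_integrals_zero:
  fixes h :: "'a::euclidean_space \<Rightarrow> real"
  assumes "\<Omega> \<in> sets lebesgue" and h: "integrable (lebesgue_on \<Omega>) h"
    and zero: "\<And>K. compact K \<Longrightarrow> K \<subseteq> \<Omega> \<Longrightarrow> (LINT x|lebesgue_on \<Omega>. indicator K x * h x) = 0"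
  shows "AE x in lebesgue_on \<Omega>. h x \<le> 0"
proof -
  let ?M = "lebesgue_on \<Omega>"
  have [measurable]: "h \<in> borel_measurable ?M" using h by auto
  define S where "S = {x \<in> space ?M. 0 < h x}"
  have "S \<in> sets ?M" unfolding S_def by measurable
  then have S: "S \<in> sets lebesgue" "S \<subseteq> \<Omega>"
    using assms(1) by (auto simp: sets_restrict_space_iff S_def)
  obtain C T where CT: "fsigma C" "T \<in> null_sets lebesgue" "C \<union> T = S"
    using lebesgue_set_almost_fsigma[OF S(1)] by metis
  obtain F :: "nat \<Rightarrow> 'a set" where F: "range F \<subseteq> Collect compact" "C = \<Union>(range F)"
    using CT(1) fsigma_Union_compact by metis
  have "AE x in ?M. x \<notin> F n" for n
  proof -
    have K: "compact (F n)" "F n \<subseteq> S" using F CT by auto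
    then have [measurable]: "F n \<in> sets ?M"
      using S assms(1) by (auto simp: sets_restrict_space_iff borel_compact)
    have "integrable ?M (\<lambda>x. indicator (F n) x *\<^sub>R h x)"
      using h by (intro integrable_mult_indicator) auto
    then have int: "integrable ?M (\<lambda>x. indicator (F n) x * h x)" by simp
    have "AE x in ?M. 0 \<le> indicator (F n) x * h x"
    proof (rule AE_I2)
      show "0 \<le> indicator (F n) x * h x" for x
        using K(2) by (cases "x \<in> F n") (auto simp: S_def)
    qed
    from integral_nonneg_eq_0_iff_AE[OF int this] zero[OF K(1)] K(2) S(2)
    have "AE x in ?M. indicator (F n) x * h x = 0" by auto
    then show ?thesis
      by eventually_elim (use K in \<open>auto simp: indicator_def S_def\<close>)
  qed
  then have "AE x in ?M. \<forall>n. x \<notin> F n" by (simp add: AE_all_countable)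
  moreover have "AE x in ?M. x \<notin> T"
    using AE_not_in[OF CT(2)] assms(1) by (subst AE_restrict_space_iff) auto
  ultimately show ?thesis
    using AE_space
  proof eventually_elim
    case (elim x)
    then have "x \<notin> S" using CT(3) F(2) by blast
    then show ?case using elim by (auto simp: S_def)
  qed
qed

text \<open>
  Dominated convergence along test functions that tend to the indicator of \<open>U\<close>.
\<close>

lemma integral_indicator_open_eq_0:
  fixes h :: "real^3 \<Rightarrow> real"
  assumes "open \<Omega>" "open U" "U \<subseteq> \<Omega>" and h: "integrable (lebesgue_on \<Omega>) h"
    and zero: "\<And>\<phi>. \<phi> \<in> test_fun \<Omega> \<Longrightarrow> (LINT x|lebesgue_on \<Omega>. h x * \<phi> x) = 0"
  shows "(LINT x|lebesgue_on \<Omega>. indicator U x * h x) = 0"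
proof -
  let ?M = "lebesgue_on \<Omega>"
  obtain \<psi> where \<psi>: "\<And>n. \<psi> n \<in> test_fun U" "\<And>n x. \<bar>\<psi> n x\<bar> \<le> 1"
    "\<And>x. (\<lambda>n. \<psi> n x) \<longlonglongrightarrow> indicator U x"
    using indicator_open_limit_test_fun[OF assms(2)] by metis
  have [measurable]: "h \<in> borel_measurable ?M" using h by auto
  have [measurable]: "\<psi> n \<in> borel_measurable ?M" for n
    using \<psi>(1)[of n] assms(1)
    by (auto elim!: test_funE intro!: continuous_imp_measurable_on_sets_lebesgue smooth_continuous)
  have [measurable]: "U \<in> sets ?M"
    using assms by (auto simp: sets_restrict_space_iff)
  have "(\<lambda>n. LINT x|?M. h x * \<psi> n x) \<longlonglongrightarrow> (LINT x|?M. indicator U x * h x)"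
  proof (rule integral_dominated_convergence[where w="\<lambda>x. \<bar>h x\<bar>"])
    show "AE x in ?M. (\<lambda>n. h x * \<psi> n x) \<longlonglongrightarrow> indicator U x * h x"
    proof (rule AE_I2)
      fix x
      show "(\<lambda>n. h x * \<psi> n x) \<longlonglongrightarrow> indicator U x * h x"
        using tendsto_mult[OF tendsto_const[of "h x"] \<psi>(3)[of x]] by (simp only: mult.commute)
    qed
    show "AE x in ?M. norm (h x * \<psi> n x) \<le> \<bar>h x\<bar>" for n
    proof (rule AE_I2)
      show "norm (h x * \<psi> n x) \<le> \<bar>h x\<bar>" for x
        using mult_left_le[OF \<psi>(2)[of n x] abs_ge_zero[of "h x"]] by (simp add: abs_mult)
    qed
    show "integrable ?M (\<lambda>x. \<bar>h x\<bar>)" using h by (rule integrable_abs)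
  qed measurable
  moreover have "(LINT x|?M. h x * \<psi> n x) = 0" for n
    by (intro zero test_fun_mono[OF \<psi>(1) assms(3)])
  ultimately show ?thesis by (simp add: LIMSEQ_const_iff)
qed

text \<open>
  A compact \<open>K \<subseteq> \<Omega>\<close> is the difference of the open sets \<open>\<Omega>\<close> and \<open>\<Omega> - K\<close>, so \<open>h\<close> has integral zero
  over \<open>K\<close>; this holds for \<open>- h\<close> as well, and the two one-sided conclusions combine.
\<close>

lemma fundamental_lemma_calculus_of_variations:
  fixes h :: "real^3 \<Rightarrow> real"
  assumes "open \<Omega>" and h: "integrable (lebesgue_on \<Omega>) h"
    and zero: "\<And>\<phi>. \<phi> \<in> test_fun \<Omega> \<Longrightarrow> (LINT x|lebesgue_on \<Omega>. h x * \<phi> x) = 0"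
  shows "AE x in lebesgue_on \<Omega>. h x = 0"
proof -
  let ?M = "lebesgue_on \<Omega>"
  have \<Omega>: "\<Omega> \<in> sets lebesgue" using assms(1) by auto
  have K0: "(LINT x|?M. indicator K x * h x) = 0" if K: "compact K" "K \<subseteq> \<Omega>" for K
  proof -
    have o: "open (\<Omega> - K)" using K assms(1) by (simp add: compact_imp_closed open_Diff)
    have [measurable]: "\<Omega> - K \<in> sets ?M" "\<Omega> \<in> sets ?M"
      using o \<Omega> by (auto simp: sets_restrict_space_iff)
    have "(LINT x|?M. indicator K x * h x)
       = (LINT x|?M. indicator \<Omega> x * h x - indicator (\<Omega> - K) x * h x)"
      using K by (intro Bochner_Integration.integral_cong) (auto simp: indicator_def)
    also have "\<dots> = (LINT x|?M. indicator \<Omega> x * h x) - (LINT x|?M. indicator (\<Omega> - K) x * h x)"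
      using integrable_mult_indicator[OF _ h] by (intro Bochner_Integration.integral_diff) auto
    also have "\<dots> = 0"
      using integral_indicator_open_eq_0[OF assms(1) assms(1) order_refl h zero]
        integral_indicator_open_eq_0[OF assms(1) o _ h zero] by simp
    finally show ?thesis .
  qed
  have "AE x in ?M. h x \<le> 0"
    using AE_nonpos_if_compact_integrals_zero[OF \<Omega> h K0] .
  moreover have "AE x in ?M. - h x \<le> 0"
    using AE_nonpos_if_compact_integrals_zero[OF \<Omega>, of "\<lambda>x. - h x"] h K0 by simp
  ultimately show ?thesis by eventually_elim simp
qed

section \<open>Integrals of partial derivatives\<close>

lemma integral_lebesgue_on_eq_lborel:
  fixes f :: "'a::euclidean_space \<Rightarrow> real"
  assumes "open \<Omega>" "continuous_on UNIV f" "\<And>x. x \<notin> \<Omega> \<Longrightarrow> f x = 0"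
  shows "(LINT x|lebesgue_on \<Omega>. f x) = integral\<^sup>L lborel f"
proof -
  have "(LINT x|lebesgue_on \<Omega>. f x) = (LINT x|lebesgue. indicator \<Omega> x *\<^sub>R f x)"
    using assms(1) by (intro integral_restrict_space) auto
  also have "(\<lambda>x. indicator \<Omega> x *\<^sub>R f x) = f"
    using assms(3) by (auto simp: indicator_def fun_eq_iff)
  also have "integral\<^sup>L lebesgue f = integral\<^sup>L lborel f"
    using assms(2) by (intro integral_completion) (simp add: borel_measurable_continuous_onI)
  finally show ?thesis .
qed

lemma test_fun_bounded:
  assumes "\<phi> \<in> test_fun U"
  obtains B where "\<And>x. \<bar>\<phi> x\<bar> \<le> B" "B \<ge> 0"
proof -
  obtain K where K: "smooth \<phi>" "compact K" "\<And>x. x \<notin> K \<Longrightarrow> \<phi> x = 0"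
    using assms by (rule test_funE) blast
  have "bounded (\<phi> ` K)"
    using K by (intro compact_imp_bounded compact_continuous_image smooth_continuous)
  then obtain B where "\<forall>x\<in>K. norm (\<phi> x) \<le> B" "B > 0"
    by (auto simp: bounded_pos)
  then show ?thesis
    using K(3) by (intro that[of B]) (metis abs_zero less_imp_le real_norm_def, simp)
qed

lemma test_fun_integrable:
  assumes "\<phi> \<in> test_fun U"
  shows "integrable lborel \<phi>"
proof -
  obtain K where K: "smooth \<phi>" "compact K" "\<And>x. x \<notin> K \<Longrightarrow> \<phi> x = 0"
    using assms by (rule test_funE) blast
  have "integrable lborel (\<lambda>x. indicator K x *\<^sub>R \<phi> x)"
    using K by (intro borel_integrable_compact smooth_continuous)
  also have "(\<lambda>x. indicator K x *\<^sub>R \<phi> x) = \<phi>"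
    using K(3) by (auto simp: indicator_def fun_eq_iff)
  finally show ?thesis .
qed

lemma smooth_has_partial_along_axis:
  assumes "smooth F"
  shows "((\<lambda>t. F (x + t *\<^sub>R axis i 1)) has_real_derivative partial i F (x + t *\<^sub>R axis i 1)) (at t)"
proof -
  have "((\<lambda>t. x + t *\<^sub>R axis i 1) has_derivative (\<lambda>h. h *\<^sub>R axis i 1)) (at t)"
    by (auto intro!: derivative_eq_intros)
  from has_derivative_compose[OF this smooth_has_derivative[OF assms]]
  have "((\<lambda>t. F (x + t *\<^sub>R axis i 1)) has_derivative
     (\<lambda>h. frechet_derivative F (at (x + t *\<^sub>R axis i 1)) (h *\<^sub>R axis i 1))) (at t)" .
  moreover have "linear (frechet_derivative F (at (x + t *\<^sub>R axis i 1)))"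
    using smooth_has_derivative[OF assms] has_derivative_linear by blast
  ultimately show ?thesis
    by (simp add: has_field_derivative_def partial_def linear_cmul mult.commute[of _ "frechet_derivative _ _ _"])
qed

text \<open>
  Translation invariance of Lebesgue measure makes the integral of every difference quotient of \<open>F\<close>
  vanish. The difference quotients converge to the partial derivative, and by the mean value theorem
  they are bounded by the maximum of its absolute value and supported in a fixed ball.
\<close>

lemma integral_partial_test_fun:
  assumes F: "F \<in> test_fun U"
  shows "integral\<^sup>L lborel (partial i F) = 0"
proof -
  obtain K where K: "smooth F" "compact K" "\<And>x. x \<notin> K \<Longrightarrow> F x = 0"
    using F by (rule test_funE) blast
  let ?e = "axis i 1 :: real^3"
  obtain B where B: "\<And>x. \<bar>partial i F x\<bar> \<le> B" "B \<ge> 0"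
    using test_fun_bounded[OF test_fun_partial[OF F]] by blast
  obtain R where R: "\<And>x. x \<in> K \<Longrightarrow> norm x \<le> R"
    using compact_imp_bounded[OF K(2)] by (auto simp: bounded_iff)
  let ?h = "\<lambda>n. inverse (real (Suc n))"
  let ?q = "\<lambda>n x. (F (x + ?h n *\<^sub>R ?e) - F x) / ?h n"
  have [measurable]: "F \<in> borel_measurable borel" "partial i F \<in> borel_measurable borel"
    using K(1) by (auto intro!: borel_measurable_continuous_onI smooth_continuous smooth_partial)
  have "(\<lambda>n. integral\<^sup>L lborel (?q n)) \<longlonglongrightarrow> integral\<^sup>L lborel (partial i F)"
  \<comment> \<open>The steps have length at most 1, so the quotients vanish outside the ball of radius \<open>R + 1\<close>.\<close>
  proof (rule integral_dominated_convergence[where w="\<lambda>x. indicator (cball 0 (R + 1)) x *\<^sub>R B"])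
    show "integrable lborel (\<lambda>x::real^3. indicator (cball 0 (R + 1)) x *\<^sub>R B)"
      by (intro borel_integrable_compact continuous_intros) auto
    show "AE x in lborel. (\<lambda>n. ?q n x) \<longlonglongrightarrow> partial i F x"
    proof (rule AE_I2)
      fix x
      have "((\<lambda>t. (F (x + t *\<^sub>R ?e) - F x) / t) \<longlongrightarrow> partial i F x) (at 0)"
        using smooth_has_partial_along_axis[OF K(1), of x i 0] by (simp add: DERIV_def)
      moreover have "filterlim ?h (at 0) sequentially"
        by (rule filterlim_atI[OF LIMSEQ_inverse_real_of_nat]) auto
      ultimately show "(\<lambda>n. ?q n x) \<longlonglongrightarrow> partial i F x"
        by (rule filterlim_compose)
    qed
    show "AE x in lborel. norm (?q n x) \<le> indicator (cball 0 (R + 1)) x *\<^sub>R B" for n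
    proof (rule AE_I2)
      fix x :: "real^3"
      have h: "0 < ?h n" "?h n \<le> 1" by (auto simp: inverse_le_1_iff)
      show "norm (?q n x) \<le> indicator (cball 0 (R + 1)) x *\<^sub>R B"
      proof (cases "x \<in> cball 0 (R + 1)")
        case True
        obtain z where "F (x + ?h n *\<^sub>R ?e) - F (x + 0 *\<^sub>R ?e) = (?h n - 0) * partial i F (x + z *\<^sub>R ?e)"
          using MVT2[OF h(1) smooth_has_partial_along_axis[OF K(1)], of x i] by blast
        then have "?q n x = partial i F (x + z *\<^sub>R ?e)" using h by simp
        then show ?thesis using B(1) True by simp
      next
        case False
        then have x: "norm x > R + 1" by simp
        have "norm x \<le> norm (x + ?h n *\<^sub>R ?e) + norm (?h n *\<^sub>R ?e)"
          by (metis add_diff_cancel norm_triangle_ineq4)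
        also have "norm (?h n *\<^sub>R ?e) \<le> 1" using h by (simp add: norm_axis_1)
        finally have "x \<notin> K" "x + ?h n *\<^sub>R ?e \<notin> K"
          using x R[of x] R[of "x + ?h n *\<^sub>R ?e"] by auto
        then show ?thesis using K(3) False by simp
      qed
    qed
  qed measurable
  moreover have "integral\<^sup>L lborel (?q n) = 0" for n
  proof -
    have shift: "distr lborel borel ((+) (?h n *\<^sub>R ?e)) = (lborel :: (real^3) measure)"
      by (rule lborel_distr_plus)
    have eq: "F (x + ?h n *\<^sub>R ?e) = F (?h n *\<^sub>R ?e + x)" for x
      by (simp only: add.commute)
    have int: "integrable lborel (\<lambda>x. F (?h n *\<^sub>R ?e + x))"
    proof (rule integrable_distr[of "(+) (?h n *\<^sub>R ?e)" lborel borel F])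
      show "integrable (distr lborel borel ((+) (?h n *\<^sub>R ?e))) F"
        unfolding shift by (rule test_fun_integrable[OF F])
    qed measurable
    have "(LINT x|lborel. F (?h n *\<^sub>R ?e + x)) = integral\<^sup>L (distr lborel borel ((+) (?h n *\<^sub>R ?e))) F"
      by (rule integral_distr[symmetric]) measurable
    then have "(LINT x|lborel. F (?h n *\<^sub>R ?e + x)) = integral\<^sup>L lborel F"
      unfolding shift .
    then have "(LINT x|lborel. F (?h n *\<^sub>R ?e + x) - F x) = 0"
      using Bochner_Integration.integral_diff[OF int test_fun_integrable[OF F]] by simp
    then show ?thesis
      unfolding eq by (subst integral_divide_zero) simp
  qed
  ultimately show ?thesis by (simp add: LIMSEQ_const_iff)
qed

section \<open>Square integrable functions\<close>

lemma L2_measurable: "f \<in> L2 M \<Longrightarrow> f \<in> borel_measurable M"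
  by (simp add: L2_def)

lemma L2_dominated:
  assumes "f \<in> borel_measurable M" "g \<in> L2 M" "AE x in M. norm (f x) \<le> C * norm (g x)"
  shows "f \<in> L2 M"
proof -
  have "integrable M (\<lambda>x. (norm (f x))\<^sup>2)"
  proof (rule Bochner_Integration.integrable_bound)
    show "integrable M (\<lambda>x. C\<^sup>2 * (norm (g x))\<^sup>2)"
      using assms(2) by (auto simp: L2_def)
    show "AE x in M. norm ((norm (f x))\<^sup>2) \<le> norm (C\<^sup>2 * (norm (g x))\<^sup>2)"
      using assms(3)
    proof eventually_elim
      case (elim x)
      then show ?case using power_mono[OF elim norm_ge_zero, of 2] by (simp add: power_mult_distrib)
    qed
  qed (use assms(1) in measurable)
  with assms(1) show ?thesis by (simp add: L2_def)
qed

lemma L2_bounded: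
  assumes "finite_measure M" "f \<in> borel_measurable M" "\<And>x. norm (f x) \<le> B"
  shows "f \<in> L2 M"
proof (rule L2_dominated)
  interpret finite_measure M by fact
  show "(\<lambda>_. 1::real) \<in> L2 M" by (simp add: L2_def)
qed (use assms in auto)

lemma L2_add:
  assumes "f \<in> L2 M" "g \<in> L2 M"
  shows "(\<lambda>x. f x + g x) \<in> L2 M"
proof -
  have [measurable]: "f \<in> borel_measurable M" "g \<in> borel_measurable M"
    using assms by (auto simp: L2_def)
  have "integrable M (\<lambda>x. (norm (f x + g x))\<^sup>2)"
  proof (rule Bochner_Integration.integrable_bound)
    show "integrable M (\<lambda>x. 2 * (norm (f x))\<^sup>2 + 2 * (norm (g x))\<^sup>2)"
      using assms by (auto simp: L2_def)
    show "AE x in M. norm ((norm (f x + g x))\<^sup>2) \<le> norm (2 * (norm (f x))\<^sup>2 + 2 * (norm (g x))\<^sup>2)"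
    proof (rule AE_I2)
      fix x
      have "(norm (f x + g x))\<^sup>2 \<le> (norm (f x) + norm (g x))\<^sup>2"
        by (intro power_mono norm_triangle_ineq) simp
      also have "\<dots> \<le> 2 * (norm (f x))\<^sup>2 + 2 * (norm (g x))\<^sup>2"
        using sum_squares_bound[of "norm (f x)" "norm (g x)"] by (simp add: power2_sum)
      finally show "norm ((norm (f x + g x))\<^sup>2) \<le> norm (2 * (norm (f x))\<^sup>2 + 2 * (norm (g x))\<^sup>2)"
        by simp
    qed
  qed measurable
  then show ?thesis by (simp add: L2_def)
qed

lemma L2_diff:
  assumes "f \<in> L2 M" "g \<in> L2 M"
  shows "(\<lambda>x. f x - g x) \<in> L2 M"
proof -
  have "(\<lambda>x. - g x) \<in> L2 M" using assms(2) by (simp add: L2_def)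
  from L2_add[OF assms(1) this] show ?thesis by simp
qed

lemma L2_component:
  fixes f :: "'a \<Rightarrow> real^'n"
  assumes "f \<in> L2 M"
  shows "(\<lambda>x. f x $ i) \<in> L2 M"
proof (rule L2_dominated[OF _ assms, of _ 1])
  have "(\<lambda>x. f x \<bullet> axis i 1) \<in> borel_measurable M"
    using L2_measurable[OF assms] by measurable
  then show "(\<lambda>x. f x $ i) \<in> borel_measurable M" by (simp add: inner_axis)
  show "AE x in M. norm (f x $ i) \<le> 1 * norm (f x)"
    by (simp add: component_le_norm_cart)
qed

lemma L2_integrable_inner:
  assumes "f \<in> L2 M" "g \<in> L2 M"
  shows "integrable M (\<lambda>x. f x \<bullet> g x)"
proof (rule Bochner_Integration.integrable_bound)
  have [measurable]: "f \<in> borel_measurable M" "g \<in> borel_measurable M"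
    using assms by (auto simp: L2_def)
  show "(\<lambda>x. f x \<bullet> g x) \<in> borel_measurable M" by measurable
  show "integrable M (\<lambda>x. (norm (f x))\<^sup>2 + (norm (g x))\<^sup>2)"
    using assms by (auto simp: L2_def)
  show "AE x in M. norm (f x \<bullet> g x) \<le> norm ((norm (f x))\<^sup>2 + (norm (g x))\<^sup>2)"
  proof (rule AE_I2)
    fix x
    have "\<bar>f x \<bullet> g x\<bar> \<le> norm (f x) * norm (g x)" by (rule Cauchy_Schwarz_ineq2)
    moreover have "2 * (norm (f x) * norm (g x)) \<le> (norm (f x))\<^sup>2 + (norm (g x))\<^sup>2"
      using sum_squares_bound[of "norm (f x)" "norm (g x)"] by simp
    moreover have "0 \<le> norm (f x) * norm (g x)" by simp
    ultimately show "norm (f x \<bullet> g x) \<le> norm ((norm (f x))\<^sup>2 + (norm (g x))\<^sup>2)"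
      by (simp only: real_norm_def)
  qed
qed

lemma L2_inner_diff_left:
  assumes "f \<in> L2 (lebesgue_on \<Omega>)" "g \<in> L2 (lebesgue_on \<Omega>)" "h \<in> L2 (lebesgue_on \<Omega>)"
  shows "L2_inner \<Omega> (\<lambda>x. f x - g x) h = L2_inner \<Omega> f h - L2_inner \<Omega> g h"
  unfolding L2_inner_def inner_diff_left
  by (rule Bochner_Integration.integral_diff[OF L2_integrable_inner L2_integrable_inner]) fact+

lemma L2_inner_cong_AE:
  assumes "AE x in lebesgue_on \<Omega>. f x \<bullet> g x = f' x \<bullet> g' x"
    and "f \<in> L2 (lebesgue_on \<Omega>)" "g \<in> L2 (lebesgue_on \<Omega>)"
    and "f' \<in> L2 (lebesgue_on \<Omega>)" "g' \<in> L2 (lebesgue_on \<Omega>)"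
  shows "L2_inner \<Omega> f g = L2_inner \<Omega> f' g'"
  unfolding L2_inner_def
  using L2_integrable_inner[OF assms(2,3)] L2_integrable_inner[OF assms(4,5)] assms(1)
  by (intro integral_cong_AE) auto

lemma L2_inner_zero [simp]:
  "L2_inner \<Omega> (\<lambda>_. 0) f = 0" "L2_inner \<Omega> f (\<lambda>_. 0) = 0"
  by (simp_all add: L2_inner_def)

lemma finite_measure_lebesgue_on_bounded_open:
  "open \<Omega> \<Longrightarrow> bounded \<Omega> \<Longrightarrow> finite_measure (lebesgue_on \<Omega>)"
  by (simp add: finite_measure_lebesgue_on lmeasurable_open)

lemma L2_const: "open \<Omega> \<Longrightarrow> bounded \<Omega> \<Longrightarrow> (\<lambda>_. c) \<in> L2 (lebesgue_on \<Omega>)"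
  by (rule L2_bounded[where B="norm c"]) (auto intro: finite_measure_lebesgue_on_bounded_open)

lemma L2_integrable:
  fixes f :: "'a::euclidean_space \<Rightarrow> real"
  assumes "open \<Omega>" "bounded \<Omega>" "f \<in> L2 (lebesgue_on \<Omega>)"
  shows "integrable (lebesgue_on \<Omega>) f"
  using L2_integrable_inner[OF assms(3) L2_const[OF assms(1,2), of 1]] by simp

lemma test_fun_L2:
  assumes "open \<Omega>" "bounded \<Omega>" "\<phi> \<in> test_fun \<Omega>"
  shows "\<phi> \<in> L2 (lebesgue_on \<Omega>)"
proof -
  obtain B where "\<And>x. \<bar>\<phi> x\<bar> \<le> B" using test_fun_bounded[OF assms(3)] by blast
  moreover have "\<phi> \<in> borel_measurable (lebesgue_on \<Omega>)"
    using assms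
    by (auto elim!: test_funE intro!: continuous_imp_measurable_on_sets_lebesgue smooth_continuous)
  ultimately show ?thesis
    by (intro L2_bounded[where B=B] finite_measure_lebesgue_on_bounded_open assms) auto
qed

lemma grad_test_fun_L2:
  assumes "open \<Omega>" "bounded \<Omega>" "\<phi> \<in> test_fun \<Omega>"
  shows "grad \<phi> \<in> L2 (lebesgue_on \<Omega>)"
proof -
  have "\<forall>i. \<exists>B. \<forall>x. \<bar>partial i \<phi> x\<bar> \<le> B"
    using test_fun_bounded[OF test_fun_partial[OF assms(3)]] by metis
  then obtain B where B: "\<And>i x. \<bar>partial i \<phi> x\<bar> \<le> B i" by metis
  have "norm (grad \<phi> x) \<le> (\<Sum>i\<in>UNIV. B i)" for x
  proof -
    have "norm (grad \<phi> x) \<le> (\<Sum>i\<in>UNIV. \<bar>grad \<phi> x $ i\<bar>)" by (rule norm_le_l1_cart)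
    also have "\<dots> \<le> (\<Sum>i\<in>UNIV. B i)" by (intro sum_mono) (simp add: grad_def B)
    finally show ?thesis .
  qed
  moreover have "grad \<phi> \<in> borel_measurable (lebesgue_on \<Omega>)"
  proof -
    have "smooth \<phi>" using assms(3) by (rule test_funE) blast
    then have "continuous_on \<Omega> (grad \<phi>)"
      unfolding grad_def[abs_def] by (intro continuous_on_vec_lambda smooth_continuous smooth_partial)
    then show ?thesis using assms(1) by (intro continuous_imp_measurable_on_sets_lebesgue) auto
  qed
  ultimately show ?thesis
    by (intro L2_bounded finite_measure_lebesgue_on_bounded_open assms)
qed

section \<open>Weak derivatives\<close>

text \<open>
  On a bounded set square integrable functions are integrable, which makes the fundamental lemma
  applicable. It shows that weak derivatives are unique up to null sets, hence that the representatives
  \<^const>\<open>wgrad\<close> and \<^const>\<open>wdiv\<close> can be computed from any weak derivative that is at hand.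
\<close>

lemma AE_eq_if_tested_eq:
  assumes "open \<Omega>" "bounded \<Omega>" "f \<in> L2 (lebesgue_on \<Omega>)" "g \<in> L2 (lebesgue_on \<Omega>)"
    and eq: "\<And>\<phi>. \<phi> \<in> test_fun \<Omega> \<Longrightarrow> L2_inner \<Omega> f \<phi> = L2_inner \<Omega> g \<phi>"
  shows "AE x in lebesgue_on \<Omega>. f x = (g x :: real)"
proof -
  have "AE x in lebesgue_on \<Omega>. f x - g x = 0"
  proof (rule fundamental_lemma_calculus_of_variations[OF assms(1)])
    show "integrable (lebesgue_on \<Omega>) (\<lambda>x. f x - g x)"
      by (intro L2_integrable L2_diff assms)
    show "(LINT x|lebesgue_on \<Omega>. (f x - g x) * \<phi> x) = 0" if "\<phi> \<in> test_fun \<Omega>" for \<phi>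
      using L2_inner_diff_left[OF assms(3,4) test_fun_L2[OF assms(1,2) that]] eq[OF that]
      by (simp add: L2_inner_def)
  qed
  then show ?thesis by simp
qed

lemma weak_grad_unique:
  assumes "open \<Omega>" "bounded \<Omega>" "is_weak_grad \<Omega> u G" "is_weak_grad \<Omega> u H"
  shows "AE x in lebesgue_on \<Omega>. G x = H x"
proof -
  have "AE x in lebesgue_on \<Omega>. G x $ i = H x $ i" for i
  proof (rule AE_eq_if_tested_eq[OF assms(1,2)])
    show "(\<lambda>x. G x $ i) \<in> L2 (lebesgue_on \<Omega>)" "(\<lambda>x. H x $ i) \<in> L2 (lebesgue_on \<Omega>)"
      using assms by (auto simp: is_weak_grad_def intro: L2_component)
    show "L2_inner \<Omega> (\<lambda>x. G x $ i) \<phi> = L2_inner \<Omega> (\<lambda>x. H x $ i) \<phi>" if "\<phi> \<in> test_fun \<Omega>" for \<phi>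
      using assms(3,4) that unfolding is_weak_grad_def by (metis neg_equal_iff_equal)
  qed
  then have "AE x in lebesgue_on \<Omega>. \<forall>i\<in>UNIV. G x $ i = H x $ i"
    by (intro AE_finite_allI) auto
  then show ?thesis by (simp add: vec_eq_iff)
qed

lemma is_weak_grad_wgrad: "is_weak_grad \<Omega> u G \<Longrightarrow> is_weak_grad \<Omega> u (wgrad \<Omega> u)"
  unfolding wgrad_def by (rule someI[of "is_weak_grad \<Omega> u"])

lemma H1_L2: "u \<in> H1 \<Omega> \<Longrightarrow> u \<in> L2 (lebesgue_on \<Omega>)"
  by (simp add: H1_def)

lemma H1_is_weak_grad: "u \<in> H1 \<Omega> \<Longrightarrow> is_weak_grad \<Omega> u (wgrad \<Omega> u)"
  unfolding H1_def using is_weak_grad_wgrad by blast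

lemma H1_wgrad_L2: "u \<in> H1 \<Omega> \<Longrightarrow> wgrad \<Omega> u \<in> L2 (lebesgue_on \<Omega>)"
  using H1_is_weak_grad by (auto simp: is_weak_grad_def)

lemma wgrad_AE_eq:
  assumes "open \<Omega>" "bounded \<Omega>" "is_weak_grad \<Omega> u G"
  shows "AE x in lebesgue_on \<Omega>. wgrad \<Omega> u x = G x"
  using weak_grad_unique[OF assms(1,2) is_weak_grad_wgrad[OF assms(3)] assms(3)] .

lemma wdiv_AE_eq:
  assumes "open \<Omega>" "bounded \<Omega>" "is_weak_div \<Omega> r d"
  shows "AE x in lebesgue_on \<Omega>. wdiv \<Omega> r x = d x"
proof (rule AE_eq_if_tested_eq[OF assms(1,2)])
  have w: "is_weak_div \<Omega> r (wdiv \<Omega> r)"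
    unfolding wdiv_def using someI[of "is_weak_div \<Omega> r"] assms(3) .
  show "wdiv \<Omega> r \<in> L2 (lebesgue_on \<Omega>)" "d \<in> L2 (lebesgue_on \<Omega>)"
    using w assms(3) by (auto simp: is_weak_div_def)
  show "L2_inner \<Omega> (wdiv \<Omega> r) \<phi> = L2_inner \<Omega> d \<phi>" if "\<phi> \<in> test_fun \<Omega>" for \<phi>
    using w assms(3) that unfolding is_weak_div_def by (metis neg_equal_iff_equal)
qed

lemma is_weak_grad_const:
  assumes "open \<Omega>" "bounded \<Omega>"
  shows "is_weak_grad \<Omega> (\<lambda>_. c) (\<lambda>_. 0)"
  unfolding is_weak_grad_def
proof (intro conjI ballI allI)
  show "(\<lambda>_. 0) \<in> L2 (lebesgue_on \<Omega>)" by (rule L2_const[OF assms])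
  fix \<phi> i assume \<phi>: "\<phi> \<in> test_fun \<Omega>"
  have "smooth \<phi>" using \<phi> by (rule test_funE) blast
  then have "(LINT x|lebesgue_on \<Omega>. partial i \<phi> x) = integral\<^sup>L lborel (partial i \<phi>)"
    using test_fun_outside[OF test_fun_partial[OF \<phi>]]
    by (intro integral_lebesgue_on_eq_lborel assms smooth_continuous smooth_partial)
  then have "(LINT x|lebesgue_on \<Omega>. partial i \<phi> x) = 0"
    using integral_partial_test_fun[OF \<phi>] by simp
  then show "L2_inner \<Omega> (\<lambda>_. c) (partial i \<phi>) = - L2_inner \<Omega> (\<lambda>x. 0 $ i) \<phi>"
    by (simp add: L2_inner_def)
qed

lemma partial_mult:
  assumes "smooth f" "smooth g"
  shows "partial i (\<lambda>x. f x * g x) x = f x * partial i g x + partial i f x * g x"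
  using partial_eq[OF has_derivative_mult[OF smooth_has_derivative[OF assms(1)] smooth_has_derivative[OF assms(2)]]]
  by (simp add: partial_def)

text \<open>
  Integration by parts: the product of two test functions is a test function, so the integral of its
  partial derivatives vanishes.
\<close>

lemma is_weak_grad_test_fun:
  assumes "open \<Omega>" "bounded \<Omega>" "\<psi> \<in> test_fun \<Omega>"
  shows "is_weak_grad \<Omega> \<psi> (grad \<psi>)"
  unfolding is_weak_grad_def
proof (intro conjI ballI allI)
  show "grad \<psi> \<in> L2 (lebesgue_on \<Omega>)" by (rule grad_test_fun_L2[OF assms])
  fix \<phi> i assume \<phi>: "\<phi> \<in> test_fun \<Omega>"
  have s: "smooth \<phi>" "smooth \<psi>" using \<phi> assms(3) by (auto elim: test_funE)
  have \<psi>\<phi>: "(\<lambda>x. \<psi> x * \<phi> x) \<in> test_fun \<Omega>" by (rule test_fun_mult[OF \<phi> s(2)])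
  have "L2_inner \<Omega> (\<lambda>_. 1) (partial i (\<lambda>x. \<psi> x * \<phi> x)) = 0"
    using is_weak_grad_const[OF assms(1,2), of 1] \<psi>\<phi> unfolding is_weak_grad_def by simp
  moreover have "L2_inner \<Omega> (\<lambda>_. 1) (partial i (\<lambda>x. \<psi> x * \<phi> x))
      = (LINT x|lebesgue_on \<Omega>. \<psi> x \<bullet> partial i \<phi> x + partial i \<psi> x \<bullet> \<phi> x)"
    unfolding L2_inner_def partial_mult[OF s(2,1)] by simp
  moreover have "\<dots> = L2_inner \<Omega> \<psi> (partial i \<phi>) + L2_inner \<Omega> (partial i \<psi>) \<phi>"
    unfolding L2_inner_def
    by (intro Bochner_Integration.integral_add L2_integrable_inner test_fun_L2 test_fun_partial assms \<phi>)
  ultimately show "L2_inner \<Omega> \<psi> (partial i \<phi>) = - L2_inner \<Omega> (\<lambda>x. grad \<psi> x $ i) \<phi>"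
    by (simp add: grad_def)
qed

lemma is_weak_grad_diff:
  assumes "open \<Omega>" "bounded \<Omega>" "is_weak_grad \<Omega> v G" "is_weak_grad \<Omega> w H"
    and vw: "v \<in> L2 (lebesgue_on \<Omega>)" "w \<in> L2 (lebesgue_on \<Omega>)"
  shows "is_weak_grad \<Omega> (\<lambda>x. v x - w x) (\<lambda>x. G x - H x)"
  unfolding is_weak_grad_def
proof (intro conjI ballI allI)
  have GH: "G \<in> L2 (lebesgue_on \<Omega>)" "H \<in> L2 (lebesgue_on \<Omega>)"
    using assms by (auto simp: is_weak_grad_def)
  then show "(\<lambda>x. G x - H x) \<in> L2 (lebesgue_on \<Omega>)" by (rule L2_diff)
  fix \<phi> i assume \<phi>: "\<phi> \<in> test_fun \<Omega>"
  have "L2_inner \<Omega> v (partial i \<phi>) = - L2_inner \<Omega> (\<lambda>x. G x $ i) \<phi>"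
    "L2_inner \<Omega> w (partial i \<phi>) = - L2_inner \<Omega> (\<lambda>x. H x $ i) \<phi>"
    using assms \<phi> by (auto simp: is_weak_grad_def)
  then show "L2_inner \<Omega> (\<lambda>x. v x - w x) (partial i \<phi>) = - L2_inner \<Omega> (\<lambda>x. (G x - H x) $ i) \<phi>"
    using L2_inner_diff_left[OF vw test_fun_L2[OF assms(1,2) test_fun_partial[OF \<phi>]]]
      L2_inner_diff_left[OF L2_component[OF GH(1)] L2_component[OF GH(2)] test_fun_L2[OF assms(1,2) \<phi>]]
    by simp
qed

section \<open>Traces\<close>

lemma const_H1: "open \<Omega> \<Longrightarrow> bounded \<Omega> \<Longrightarrow> (\<lambda>_. c) \<in> H1 \<Omega>"
  unfolding H1_def using L2_const is_weak_grad_const by blast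

lemma H1_norm_zero:
  assumes "open \<Omega>" "bounded \<Omega>"
  shows "H1_norm \<Omega> (\<lambda>_. 0) = 0"
proof -
  have "L2_inner \<Omega> (wgrad \<Omega> (\<lambda>_. 0)) (wgrad \<Omega> (\<lambda>_. 0)) = L2_inner \<Omega> (\<lambda>_. 0) (\<lambda>_. 0)"
    using wgrad_AE_eq[OF assms is_weak_grad_const[OF assms, of 0]]
      H1_wgrad_L2[OF const_H1[OF assms, of 0]] L2_const[OF assms, of 0]
    by (intro L2_inner_cong_AE) auto
  then show ?thesis by (simp add: H1_norm_def)
qed

text \<open>
  The constant sequence \<open>w\<close> approximates \<open>w\<close> and equals \<open>c\<close> on the boundary.
\<close>

lemma has_trace_smooth:
  assumes "open \<Omega>" "bounded \<Omega>" "smooth w" "w \<in> H1 \<Omega>" "\<And>x. x \<in> frontier \<Omega> \<Longrightarrow> w x = c"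
  shows "has_trace \<Omega> w (\<lambda>_. c)"
  unfolding has_trace_def
proof (intro conjI exI[of _ "\<lambda>_. w"] allI)
  have "(\<integral>\<^sup>+x. ennreal ((w x - c)\<^sup>2) \<partial>surface \<Omega>) = (\<integral>\<^sup>+x. 0 \<partial>surface \<Omega>)"
    using assms(5) by (intro nn_integral_cong) (auto simp: surface_def space_restrict_space)
  then show "(\<lambda>n. \<integral>\<^sup>+x. ennreal ((w x - c)\<^sup>2) \<partial>surface \<Omega>) \<longlonglongrightarrow> 0" by simp
qed (use assms H1_norm_zero in auto)

text \<open>
  Subtracting \<open>c\<close> from an approximating sequence changes none of the differences that have to
  converge. With \<open>c = 1\<close> this reduces functions of trace \<open>1\<close> to functions of trace \<open>0\<close>.
\<close>

lemma has_trace_diff_const: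
  assumes "open \<Omega>" "bounded \<Omega>" "has_trace \<Omega> v t"
  shows "has_trace \<Omega> (\<lambda>x. v x - c) (\<lambda>x. t x - c)"
proof -
  from assms(3) obtain W where v: "v \<in> H1 \<Omega>" and t: "t \<in> borel_measurable (surface \<Omega>)"
    and W: "\<And>n. smooth (W n)" "(\<lambda>n. H1_norm \<Omega> (\<lambda>x. W n x - v x)) \<longlonglongrightarrow> 0"
      "(\<lambda>n. \<integral>\<^sup>+x. ennreal ((W n x - t x)\<^sup>2) \<partial>surface \<Omega>) \<longlonglongrightarrow> 0"
    unfolding has_trace_def by blast
  show ?thesis
    unfolding has_trace_def
  proof (intro conjI exI[of _ "\<lambda>n x. W n x - c"] allI)
    show "(\<lambda>x. v x - c) \<in> H1 \<Omega>"
      unfolding H1_def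
      using L2_diff[OF H1_L2[OF v] L2_const[OF assms(1,2), of c]]
        is_weak_grad_diff[OF assms(1,2) H1_is_weak_grad[OF v] is_weak_grad_const[OF assms(1,2)]
          H1_L2[OF v] L2_const[OF assms(1,2)], of c] by blast
    show "smooth (\<lambda>x. W n x - c)" for n
      by (rule smooth_diff[OF W(1) smooth_const])
  qed (use t W in auto)
qed

lemma test_fun_H1_zero:
  assumes "open \<Omega>" "bounded \<Omega>" "\<phi> \<in> test_fun \<Omega>"
  shows "\<phi> \<in> H1_zero \<Omega>"
proof -
  have "\<phi> \<in> H1 \<Omega>"
    unfolding H1_def using test_fun_L2[OF assms] is_weak_grad_test_fun[OF assms] by blast
  moreover have "smooth \<phi>" using assms(3) by (rule test_funE) blast
  moreover have "\<phi> x = 0" if "x \<in> frontier \<Omega>" for x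
    using that assms(1) by (intro test_fun_outside[OF assms(3)]) (auto simp: frontier_def interior_open)
  ultimately show ?thesis
    unfolding H1_zero_def using has_trace_smooth[OF assms(1,2)] by blast
qed

lemma H1_zero_subset_H1_Gamma: "H1_zero \<Omega> \<subseteq> H1_Gamma \<Omega>"
  by (force simp: H1_zero_def H1_Gamma_def)

section \<open>Fields orthogonal to the gradients of functions with zero trace\<close>

text \<open>
  Test functions have zero trace and their weak gradient is the classical one.
\<close>

lemma weak_div_free_if_orthogonal:
  assumes "open \<Omega>" "bounded \<Omega>" and r: "r \<in> L2 (lebesgue_on \<Omega>)"
    and orth: "\<And>v. v \<in> H1_zero \<Omega> \<Longrightarrow> L2_inner \<Omega> r (wgrad \<Omega> v) = 0"
  shows "is_weak_div \<Omega> r (\<lambda>_. 0)"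
  unfolding is_weak_div_def
proof (intro conjI ballI)
  show "(\<lambda>_. 0) \<in> L2 (lebesgue_on \<Omega>)" by (rule L2_const[OF assms(1,2)])
  fix \<phi> assume \<phi>: "\<phi> \<in> test_fun \<Omega>"
  have "L2_inner \<Omega> r (grad \<phi>) = L2_inner \<Omega> r (wgrad \<Omega> \<phi>)"
  proof (rule L2_inner_cong_AE)
    show "AE x in lebesgue_on \<Omega>. r x \<bullet> grad \<phi> x = r x \<bullet> wgrad \<Omega> \<phi> x"
      using wgrad_AE_eq[OF assms(1,2) is_weak_grad_test_fun[OF assms(1,2) \<phi>]] by eventually_elim simp
    show "wgrad \<Omega> \<phi> \<in> L2 (lebesgue_on \<Omega>)"
      using test_fun_H1_zero[OF assms(1,2) \<phi>] by (auto simp: H1_zero_def intro: H1_wgrad_L2)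
  qed (use r grad_test_fun_L2[OF assms(1,2) \<phi>] in auto)
  then show "L2_inner \<Omega> r (grad \<phi>) = - L2_inner \<Omega> (\<lambda>_. 0) \<phi>"
    using orth[OF test_fun_H1_zero[OF assms(1,2) \<phi>]] by simp
qed

text \<open>
  The pairing is computed from an arbitrary extension \<open>v\<close> of the boundary value \<open>1\<close>. Then \<open>v - 1\<close> has
  zero trace and the same weak gradient as \<open>v\<close>, so the gradient term of Green's formula is zero; the
  divergence term is zero because \<open>r\<close> is divergence free. Every extension thus gives the value \<open>0\<close>.
  The constant function \<open>1\<close> is an extension, which makes the pairing well defined.
\<close>

lemma normal_pairing_one_eq_0_if_orthogonal:
  assumes "open \<Omega>" "bounded \<Omega>" and r: "r \<in> L2 (lebesgue_on \<Omega>)"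
    and orth: "\<And>v. v \<in> H1_zero \<Omega> \<Longrightarrow> L2_inner \<Omega> r (wgrad \<Omega> v) = 0"
  shows "normal_pairing \<Omega> r (\<lambda>_. 1) = 0"
proof -
  note div0 = weak_div_free_if_orthogonal[OF assms(1,2) r orth]
  have wdiv: "is_weak_div \<Omega> r (wdiv \<Omega> r)"
    unfolding wdiv_def using someI[of "is_weak_div \<Omega> r"] div0 .
  have Green: "L2_inner \<Omega> r (wgrad \<Omega> v) + L2_inner \<Omega> (wdiv \<Omega> r) v = 0"
    if v: "has_trace \<Omega> v (\<lambda>_. 1)" for v
  proof -
    let ?w = "\<lambda>x. v x - 1"
    have vH: "v \<in> H1 \<Omega>" using v by (simp add: has_trace_def)
    have "has_trace \<Omega> ?w (\<lambda>_. 0)"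
      using has_trace_diff_const[OF assms(1,2) v, of 1] by simp
    then have w: "?w \<in> H1_zero \<Omega>" by (simp add: H1_zero_def has_trace_def)
    then have wH: "?w \<in> H1 \<Omega>" by (simp add: H1_zero_def)
    have "is_weak_grad \<Omega> ?w (wgrad \<Omega> v)"
      using is_weak_grad_diff[OF assms(1,2) H1_is_weak_grad[OF vH] is_weak_grad_const[OF assms(1,2)]
          H1_L2[OF vH] L2_const[OF assms(1,2)], of 1] by simp
    from wgrad_AE_eq[OF assms(1,2) this]
    have "L2_inner \<Omega> r (wgrad \<Omega> v) = L2_inner \<Omega> r (wgrad \<Omega> ?w)"
      using r H1_wgrad_L2[OF vH] H1_wgrad_L2[OF wH]
      by (intro L2_inner_cong_AE) auto
    also have "\<dots> = 0" using orth[OF w] .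
    finally have "L2_inner \<Omega> r (wgrad \<Omega> v) = 0" .
    moreover have "L2_inner \<Omega> (wdiv \<Omega> r) v = L2_inner \<Omega> (\<lambda>_. 0) v"
      using wdiv_AE_eq[OF assms(1,2) div0] wdiv H1_L2[OF vH] L2_const[OF assms(1,2), of 0]
      by (intro L2_inner_cong_AE) (auto simp: is_weak_div_def)
    ultimately show ?thesis by simp
  qed
  have one: "has_trace \<Omega> (\<lambda>_. 1) (\<lambda>_. 1)"
    by (rule has_trace_smooth[OF assms(1,2) smooth_const const_H1[OF assms(1,2)]]) simp
  show ?thesis
    unfolding normal_pairing_def
  proof (rule the_equality)
    show "\<exists>v. has_trace \<Omega> v (\<lambda>_. 1) \<and> 0 = L2_inner \<Omega> r (wgrad \<Omega> v) + L2_inner \<Omega> (wdiv \<Omega> r) v"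
      using one Green[OF one] by metis
  qed (use Green in metis)
qed

section \<open>Coefficients\<close>

lemma matrix_vector_mult_L2:
  fixes A :: "'a \<Rightarrow> real^3^3"
  assumes A: "A \<in> Linf M" and G: "G \<in> L2 M"
  shows "(\<lambda>x. A x *v G x) \<in> L2 M"
proof -
  obtain C where [measurable]: "A \<in> borel_measurable M" and C: "AE x in M. norm (A x) \<le> C"
    using A by (auto simp: Linf_def)
  have "continuous_on UNIV (\<lambda>z::(real^3^3) \<times> (real^3). fst z *v snd z)"
    unfolding matrix_vector_mult_def by (intro continuous_intros)
  then have "(\<lambda>x. A x *v G x) \<in> borel_measurable M"
    by (rule borel_measurable_continuous_Pair[OF \<open>A \<in> borel_measurable M\<close> L2_measurable[OF G]])
  moreover have "AE x in M. norm (A x *v G x) \<le> (9 * C) * norm (G x)"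
    using C
  proof eventually_elim
    case (elim x)
    have "\<bar>A x $ i $ j\<bar> \<le> C" for i j
      using component_le_norm_cart[of "A x $ i" j] Finite_Cartesian_Product.norm_nth_le[of "A x" i] elim by linarith
    \<comment> \<open>A matrix of size 3 by 3 has 9 entries.\<close>
    then have "onorm ((*v) (A x)) \<le> 9 * C"
      using onorm_le_matrix_component[of "A x" C] by simp
    moreover have "norm (A x *v G x) \<le> onorm ((*v) (A x)) * norm (G x)"
      by (rule onorm) simp
    ultimately show ?case
      by (meson mult_right_mono norm_ge_zero order_trans)
  qed
  ultimately show ?thesis using L2_dominated[OF _ G] by blast
qed

lemma invertible_if_coercive:
  fixes A :: "real^'n^'n"
  assumes "\<alpha> > 0" "\<And>\<xi>. \<alpha> * (norm \<xi>)\<^sup>2 \<le> \<xi> \<bullet> (A *v \<xi>)"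
  shows "invertible A"
proof -
  have "\<xi> = 0" if "A *v \<xi> = 0" for \<xi>
    using assms(2)[of \<xi>] that assms(1) by (simp add: mult_le_0_iff)
  then show ?thesis
    using matrix_left_invertible_ker invertible_left_inverse by blast
qed

lemma matrix_inv_mult_vector:
  fixes A :: "real^'n^'n"
  assumes "invertible A"
  shows "matrix_inv A *v (A *v x) = x"
proof -
  have "matrix_inv A ** A = mat 1"
    using assms unfolding invertible_def matrix_inv_def by (metis (mono_tags, lifting) someI_ex)
  then show ?thesis by (simp add: matrix_vector_mul_assoc)
qed

section \<open>The vector potential\<close>

text \<open>
  The orthogonality of \<open>A p\<close> to gradients comes from subtracting the two weak formulations, which may
  both be tested with functions of zero trace; the symmetry of \<open>A\<close> moves one factor \<open>A\<close> from the test
  function to \<open>p\<close>.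
\<close>

theorem proposition2p3:
  fixes \<Omega> :: "(real^3) set"
    and A :: "real^3 \<Rightarrow> real^3^3"
    and f :: "(real^3 \<Rightarrow> real) \<Rightarrow> real"
    and g u u' :: "real^3 \<Rightarrow> real"
    and p :: "real^3 \<Rightarrow> real^3"
  assumes "bounded_lipschitz_domain \<Omega>"
    and "connected (frontier \<Omega>)"
    and "curl_range \<Omega> =
          {r \<in> Hdiv \<Omega>. (AE x in lebesgue_on \<Omega>. wdiv \<Omega> r x = 0) \<and>
                       normal_pairing \<Omega> r (\<lambda>_. 1) = 0}"
    and "admissible_coeff \<Omega> A"
    and "f \<in> H1_Gamma_dual \<Omega>"
    and "g \<in> Hhalf \<Omega>"
    and "u \<in> H1_bc \<Omega> g"
    and "\<forall>v\<in>H1_zero \<Omega>.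
          L2_inner \<Omega> (\<lambda>x. A x *v wgrad \<Omega> u x) (\<lambda>x. A x *v wgrad \<Omega> v x) = f v"
    and "u' \<in> H1_Gamma \<Omega>"
    and "\<forall>v\<in>H1_Gamma \<Omega>.
          L2_inner \<Omega> (\<lambda>x. A x *v wgrad \<Omega> u' x) (\<lambda>x. A x *v wgrad \<Omega> v x) = f v"
    and "p = (\<lambda>x. A x *v wgrad \<Omega> u' x - A x *v wgrad \<Omega> u x)"
  shows "\<exists>\<phi>\<in>Hcurl \<Omega>. AE x in lebesgue_on \<Omega>. p x = matrix_inv (A x) *v wcurl \<Omega> \<phi> x"
proof -
  let ?M = "lebesgue_on \<Omega>"
  have \<Omega>: "open \<Omega>" "bounded \<Omega>"
    using assms(1) by (auto simp: bounded_lipschitz_domain_def)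
  have A: "A \<in> Linf ?M" and sym: "AE x in ?M. transpose (A x) = A x"
    using assms(4) by (auto simp: admissible_coeff_def)
  obtain \<alpha> where \<alpha>: "\<alpha> > 0" "AE x in ?M. \<forall>\<xi>. \<alpha> * (norm \<xi>)\<^sup>2 \<le> \<xi> \<bullet> (A x *v \<xi>)"
    using assms(4) by (auto simp: admissible_coeff_def)
  have u: "u \<in> H1 \<Omega>" "u' \<in> H1 \<Omega>"
    using assms(7,9) by (auto simp: H1_bc_def H1_Gamma_def)
  note AL2 = matrix_vector_mult_L2[OF A]
  have p: "p \<in> L2 ?M"
    unfolding assms(11) by (intro L2_diff AL2 H1_wgrad_L2 u)
  define r where "r = (\<lambda>x. A x *v p x)"
  have r: "r \<in> L2 ?M" unfolding r_def by (rule AL2[OF p])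
  have orth: "L2_inner \<Omega> r (wgrad \<Omega> v) = 0" if v: "v \<in> H1_zero \<Omega>" for v
  proof -
    have Gv: "wgrad \<Omega> v \<in> L2 ?M" using v by (auto simp: H1_zero_def intro: H1_wgrad_L2)
    have "L2_inner \<Omega> r (wgrad \<Omega> v) = L2_inner \<Omega> p (\<lambda>x. A x *v wgrad \<Omega> v x)"
    proof (rule L2_inner_cong_AE)
      show "AE x in ?M. r x \<bullet> wgrad \<Omega> v x = p x \<bullet> (A x *v wgrad \<Omega> v x)"
        using sym
      proof eventually_elim
        case (elim x)
        have "r x = p x v* A x"
          unfolding r_def using transpose_matrix_vector[of "A x" "p x"] elim by simp
        then show ?case by (simp add: dot_lmul_matrix)
      qed
    qed (use p r Gv AL2 in auto)
    also have "\<dots> = f v - f v"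
      unfolding assms(11)
      using v H1_zero_subset_H1_Gamma assms(8,10)
      by (subst L2_inner_diff_left[OF AL2 AL2 AL2]) (auto intro: H1_wgrad_L2 u Gv)
    finally show ?thesis by simp
  qed
  have div0: "is_weak_div \<Omega> r (\<lambda>_. 0)"
    by (rule weak_div_free_if_orthogonal[OF \<Omega> r orth])
  then have "r \<in> Hdiv \<Omega>" using r by (auto simp: Hdiv_def)
  moreover have "AE x in ?M. wdiv \<Omega> r x = 0"
    by (rule wdiv_AE_eq[OF \<Omega> div0])
  moreover have "normal_pairing \<Omega> r (\<lambda>_. 1) = 0"
    by (rule normal_pairing_one_eq_0_if_orthogonal[OF \<Omega> r orth])
  ultimately have "r \<in> curl_range \<Omega>" unfolding assms(3) by simp
  then obtain \<phi> where \<phi>: "\<phi> \<in> Hcurl \<Omega>" "AE x in ?M. r x = wcurl \<Omega> \<phi> x"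
    by (auto simp: curl_range_def)
  have "AE x in ?M. p x = matrix_inv (A x) *v wcurl \<Omega> \<phi> x"
    using \<phi>(2) \<alpha>(2)
  proof eventually_elim
    case (elim x)
    have "invertible (A x)"
      using \<alpha>(1) elim(2) by (intro invertible_if_coercive) auto
    then have "p x = matrix_inv (A x) *v r x"
      unfolding r_def by (simp add: matrix_inv_mult_vector)
    then show ?case using elim(1) by simp
  qed
  then show ?thesis using \<phi>(1) by blast
qed

end
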